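(* Let $F_1,F_2\colon\mathbb{R}^n\rightrightarrows\mathbb{R}^p$ be set-valued mappings with convex graphs such that $$\mathrm{ri}(\mathrm{gph}(F_1))\cap\mathrm{ri}(\mathrm{gph}(F_2))\neq\emptyset.$$ Then $$D^*(F_1+F_2)(\bar{x},\bar{y})(v)=\bigcap_{(\bar{y}_1,\bar{y}_2)\in S(\bar{x},\bar{y})}\big[D^*F_1(\bar{x},\bar{y}_1)(v)+D^*F_2(\bar{x},\bar{y}_2)(v)\big]$$ for all $(\bar{x},\bar{y})\in\mathrm{gph}(F_1+F_2)$ and $v\in\mathbb{R}^p$, where $$S(\bar{x},\bar{y}):=\{(\bar{y}_1,\bar{y}_2)\in\mathbb{R}^p\times\mathbb{R}^p : \bar{y}=\bar{y}_1+\bar{y}_2,\ \bar{y}_i\in F_i(\bar{x})\text{ for }i=1,2\}.$$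
   Context: A set-valued mapping $F\colon\mathbb{R}^n\rightrightarrows\mathbb{R}^p$ assigns to each $x$ a set $F(x)\subset\mathbb{R}^p$ (possibly empty); $\mathrm{gph}(F):=\{(x,y) : y\in F(x)\}$. The sum is $(F_1+F_2)(x):=\{y_1+y_2 : y_1\in F_1(x),\ y_2\in F_2(x)\}$. For a convex set $\Omega$ and $\bar{x}\in\Omega$, the normal cone is $N(\bar{x};\Omega):=\{v : \langle v,x-\bar{x}\rangle\le 0\text{ for all }x\in\Omega\}$. The coderivative of $F$ at $(\bar{x},\bar{y})\in\mathrm{gph}(F)$ is $D^*F(\bar{x},\bar{y})(v):=\{u\in\mathbb{R}^n : (u,-v)\in N((\bar{x},\bar{y});\mathrm{gph}(F))\}$, $v\in\mathbb{R}^p$. The relative interior $\mathrm{ri}(\Omega)$ of a convex set $\Omega$ is the set of $x\in\Omega$ for which there is $\gamma>0$ with $\mathbb{B}(x;\gamma)\cap\mathrm{aff}(\Omega)\subset\Omega$ (closed ball, affine hull). Sums of sets are Minkowski sums. *)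

theory Defs
  imports "HOL-Analysis.Analysis"
begin

(* A set-valued mapping is a function into sets; the value may be empty. *)

definition gph :: "('a \<Rightarrow> 'b set) \<Rightarrow> ('a \<times> 'b) set" where
  "gph F = {(x, y). y \<in> F x}"

definition setmap_sum :: "('a \<Rightarrow> 'b::plus set) \<Rightarrow> ('a \<Rightarrow> 'b set) \<Rightarrow> 'a \<Rightarrow> 'b set" where
  "setmap_sum F1 F2 x = {y1 + y2 | y1 y2. y1 \<in> F1 x \<and> y2 \<in> F2 x}"

(* Only meaningful for convex \<Omega> and xb \<in> \<Omega>. *)
definition normal_cone :: "'a::real_inner \<Rightarrow> 'a set \<Rightarrow> 'a set" where
  "normal_cone xb \<Omega> = {v. \<forall>x\<in>\<Omega>. inner v (x - xb) \<le> 0}"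

(* Only meaningful when gph F is convex and (xb, yb) \<in> gph F. *)
definition coderivative ::
  "('a::real_inner \<Rightarrow> 'b::real_inner set) \<Rightarrow> 'a \<Rightarrow> 'b \<Rightarrow> 'b \<Rightarrow> 'a set" where
  "coderivative F xb yb v = {u. (u, - v) \<in> normal_cone (xb, yb) (gph F)}"

definition sum_decomp ::
  "('a \<Rightarrow> 'b::plus set) \<Rightarrow> ('a \<Rightarrow> 'b set) \<Rightarrow> 'a \<Rightarrow> 'b \<Rightarrow> ('b \<times> 'b) set" where
  "sum_decomp F1 F2 xb yb = {(y1, y2). yb = y1 + y2 \<and> y1 \<in> F1 xb \<and> y2 \<in> F2 xb}"

end

theory Submission
  imports Defs
begin

text \<open>
  The inclusion from right to left only needs one decomposition: the normal-cone inequalities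
  for \<open>gph F1\<close> and \<open>gph F2\<close> at points over the same \<open>x\<close> add up to the one for the sum.

  For the other inclusion, \<open>u\<close> lies in the coderivative of the sum exactly when
  \<open>((x1, z1), (x2, z2)) = ((xb, y1), (xb, y2))\<close> maximises the linear functional
  \<open>inner u x2 - inner v z1 - inner v z2\<close> over \<open>gph F1 \<times> gph F2\<close> subject to the linear
  constraint \<open>x1 - x2 = 0\<close>, whatever the decomposition \<open>(y1, y2)\<close>. The common relative interior
  point of the graphs is a Slater point of this program, so the constraint can be traded for a
  Lagrange multiplier \<open>w\<close> (lemma \<open>lagrange_multiplier_linear_constraint\<close>). The resulting
  unconstrained inequality, with either of its two points fixed at the maximiser, says that
  \<open>-w\<close> and \<open>u + w\<close> belong to the two coderivatives; their sum is \<open>u\<close>.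
\<close>

text \<open>
  The points lying strictly below the image of \<open>S\<close> under \<open>p \<mapsto> (h p, g p - c)\<close> form a convex set
  that misses the origin. A hyperplane through the origin with this set on one side yields the
  multiplier as its slope, unless it is vertical. Choosing the normal inside the span of
  the set excludes a vertical hyperplane: its normal would be \<open>(a, 0)\<close> with \<open>a \<noteq> 0\<close> in the
  span of \<open>h ` S\<close> and \<open>inner a\<close> nonnegative on \<open>h ` S\<close>, whereas \<open>h ` S\<close>, having \<open>0\<close> as a
  relative interior point, contains a negative multiple of \<open>a\<close>.
\<close>
lemma lagrange_multiplier_linear_constraint:
  fixes h :: "'a::euclidean_space \<Rightarrow> 'b::euclidean_space" and g :: "'a \<Rightarrow> real"
  assumes S: "convex S" and h: "linear h" and g: "linear g"
    and p0: "p0 \<in> rel_interior S" "h p0 = 0"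
    and le: "\<And>p. p \<in> S \<Longrightarrow> h p = 0 \<Longrightarrow> g p \<le> c"
  shows "\<exists>w. \<forall>p\<in>S. g p \<le> c + inner w (h p)"
proof -
  define T where "T = (\<lambda>(p, e). (h p, g p - c - e)) ` (S \<times> {0<..})"
  have p0S: "p0 \<in> S"
    using p0 rel_interior_subset by blast
  have "T = (+) (0, - c) ` ((\<lambda>(p, e). (h p, g p - e)) ` (S \<times> {0<..}))"
    unfolding T_def image_image by (rule image_cong) auto
  moreover have "linear (\<lambda>(p, e). (h p, g p - e))"
    by (rule linearI)
      (auto simp: linear_add[OF h] linear_add[OF g] linear_scale[OF h] linear_scale[OF g]
        algebra_simps)
  ultimately have "convex T"
    by (simp only: convex_translation convex_linear_image convex_Times S convex_real_interval)
  moreover have "T \<noteq> {}"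
    using p0S unfolding T_def by (auto intro: exI[of _ 1])
  moreover have "0 \<notin> T"
    using le unfolding T_def by (force simp: zero_prod_def)
  ultimately obtain n where n: "n \<in> span T" "n \<noteq> 0" "\<And>t. t \<in> T \<Longrightarrow> 0 \<le> inner n t"
    using separating_hyperplane_set_0_inspan[of T] by blast
  obtain a \<alpha> where aal: "n = (a, \<alpha>)"
    by (cases n)
  have sep: "\<alpha> * e \<le> inner a (h p) + \<alpha> * (g p - c)" if "p \<in> S" "e > 0" for p e
  proof -
    have "(h p, g p - c - e) \<in> T"
      using that unfolding T_def by force
    from n(3)[OF this] show ?thesis
      by (simp add: aal inner_prod_def algebra_simps)
  qed
  \<comment> \<open>The set \<open>T\<close> is unbounded below in the vertical direction, so its normal cannot point upwards.\<close>
  have "\<alpha> \<le> 0"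
  proof (rule ccontr)
    assume "\<not> \<alpha> \<le> 0"
    define e where "e = (\<bar>\<alpha> * (g p0 - c)\<bar> + 1) / \<alpha>"
    have "e > 0" "\<alpha> * e = \<bar>\<alpha> * (g p0 - c)\<bar> + 1"
      using \<open>\<not> \<alpha> \<le> 0\<close> by (auto simp: e_def)
    then show False
      using sep[OF p0S, of e] p0(2) by simp
  qed
  moreover have "\<alpha> \<noteq> 0"
  proof
    assume "\<alpha> = 0"
    then have nonneg: "0 \<le> inner a (h p)" if "p \<in> S" for p
      using sep[OF that, of 1] by simp
    have "fst ` T \<subseteq> h ` S"
      by (auto simp: T_def)
    then have "a \<in> span (h ` S)"
      using n(1) linear_span_image[OF linear_fst, of T] span_mono[of "fst ` T" "h ` S"]
      by (force simp: aal)
    have "0 \<in> h ` rel_interior S"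
      using p0 by force
    then have ri: "0 \<in> rel_interior (h ` S)"
      using rel_interior_convex_linear_image[OF h S] by simp
    then have "affine hull (h ` S) = span (h ` S)"
      using rel_interior_subset by (intro affine_hull_span_0 hull_inc) blast
    with ri obtain e where e: "e > 0" "cball 0 e \<inter> span (h ` S) \<subseteq> h ` S"
      unfolding mem_rel_interior_cball by auto
    have "a \<noteq> 0"
      using n(2) \<open>\<alpha> = 0\<close> by (simp add: aal zero_prod_def)
    have "(- e / norm a) *\<^sub>R a \<in> cball 0 e \<inter> span (h ` S)"
      using e(1) \<open>a \<noteq> 0\<close> \<open>a \<in> span (h ` S)\<close> by (auto intro!: span_neg span_scale)
    then obtain p where "p \<in> S" "h p = (- e / norm a) *\<^sub>R a"
      using e(2) by (metis (no_types, lifting) imageE subsetD)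
    with nonneg[of p] have "(e / norm a) * inner a a \<le> 0"
      by simp
    moreover have "(e / norm a) * inner a a > 0"
      using e(1) \<open>a \<noteq> 0\<close> by simp
    ultimately show False
      by simp
  qed
  ultimately have "\<alpha> < 0"
    by simp
  have "g p \<le> c + inner ((- 1 / \<alpha>) *\<^sub>R a) (h p)" if "p \<in> S" for p
  proof (rule field_le_epsilon)
    fix e :: real
    assume "e > 0"
    from sep[OF that this] \<open>\<alpha> < 0\<close>
    show "g p \<le> c + inner ((- 1 / \<alpha>) *\<^sub>R a) (h p) + e"
      by (simp add: field_simps)
  qed
  then show ?thesis
    by blast
qed

lemma coderivative_iff:
  "u \<in> coderivative F xb yb v \<longleftrightarrow>
    (\<forall>x y. y \<in> F x \<longrightarrow> inner u (x - xb) \<le> inner v (y - yb))"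
  by (auto simp: coderivative_def normal_cone_def gph_def inner_prod_def)

lemma coderivative_setmap_sum_iff:
  "u \<in> coderivative (setmap_sum F1 F2) xb (y1 + y2) v \<longleftrightarrow>
    (\<forall>x z1 z2. z1 \<in> F1 x \<longrightarrow> z2 \<in> F2 x \<longrightarrow>
      inner u (x - xb) \<le> inner v (z1 - y1) + inner v (z2 - y2))"
proof -
  have "inner v (z1 + z2 - (y1 + y2)) = inner v (z1 - y1) + inner v (z2 - y2)" for z1 z2
    by (simp add: algebra_simps)
  then show ?thesis
    unfolding coderivative_iff setmap_sum_def by fastforce
qed

lemma coderivative_sum_subset:
  "coderivative F1 xb y1 v + coderivative F2 xb y2 v
    \<subseteq> coderivative (setmap_sum F1 F2) xb (y1 + y2) v"
proof
  fix u
  assume "u \<in> coderivative F1 xb y1 v + coderivative F2 xb y2 v"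
  then obtain u1 u2 where "u = u1 + u2"
    "u1 \<in> coderivative F1 xb y1 v" "u2 \<in> coderivative F2 xb y2 v"
    by (rule set_plus_elim)
  then show "u \<in> coderivative (setmap_sum F1 F2) xb (y1 + y2) v"
    unfolding coderivative_setmap_sum_iff unfolding coderivative_iff
    by (auto simp: inner_add_left intro: add_mono)
qed

lemma coderivative_setmap_sum_subset:
  fixes F1 F2 :: "'a::euclidean_space \<Rightarrow> 'b::euclidean_space set"
  assumes conv: "convex (gph F1)" "convex (gph F2)"
    and ri: "rel_interior (gph F1) \<inter> rel_interior (gph F2) \<noteq> {}"
    and y: "y1 \<in> F1 xb" "y2 \<in> F2 xb"
  shows "coderivative (setmap_sum F1 F2) xb (y1 + y2) v
    \<subseteq> coderivative F1 xb y1 v + coderivative F2 xb y2 v"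
proof
  fix u
  assume "u \<in> coderivative (setmap_sum F1 F2) xb (y1 + y2) v"
  then have u: "inner u (x - xb) \<le> inner v (z1 - y1) + inner v (z2 - y2)"
    if "z1 \<in> F1 x" "z2 \<in> F2 x" for x z1 z2
    using that unfolding coderivative_setmap_sum_iff by blast
  define S where "S = gph F1 \<times> gph F2"
  define h :: "('a \<times> 'b) \<times> ('a \<times> 'b) \<Rightarrow> 'a" where "h = (\<lambda>((x1, z1), (x2, z2)). x1 - x2)"
  define g :: "('a \<times> 'b) \<times> ('a \<times> 'b) \<Rightarrow> real"
    where "g = (\<lambda>((x1, z1), (x2, z2)). inner u x2 - inner v z1 - inner v z2)"
  obtain q where q: "q \<in> rel_interior (gph F1)" "q \<in> rel_interior (gph F2)"
    using ri by blast
  have "\<exists>w. \<forall>p\<in>S. g p \<le> (inner u xb - inner v y1 - inner v y2) + inner w (h p)"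
  proof (rule lagrange_multiplier_linear_constraint)
    show "convex S"
      by (simp add: S_def convex_Times conv)
    show "linear h" "linear g"
      by (auto intro!: linearI simp: h_def g_def algebra_simps)
    show "(q, q) \<in> rel_interior S"
      using q by (simp add: S_def rel_interior_Times conv)
    show "h (q, q) = 0"
      by (simp add: h_def split: prod.split)
    show "g p \<le> inner u xb - inner v y1 - inner v y2" if p: "p \<in> S" "h p = 0" for p
    proof -
      obtain x z1 z2 where "p = ((x, z1), (x, z2))" "z1 \<in> F1 x" "z2 \<in> F2 x"
        using p by (auto simp: S_def gph_def h_def)
      then show ?thesis
        using u[of z1 x z2] by (simp add: g_def algebra_simps)
    qed
  qed
  then obtain w where w: "inner u x2 - inner v z1 - inner v z2
      \<le> inner u xb - inner v y1 - inner v y2 + inner w (x1 - x2)"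
    if "z1 \<in> F1 x1" "z2 \<in> F2 x2" for x1 z1 x2 z2
    unfolding S_def gph_def g_def h_def by fastforce
  have "- w \<in> coderivative F1 xb y1 v"
    unfolding coderivative_iff using w[OF _ y(2)] by (force simp: algebra_simps)
  moreover have "u + w \<in> coderivative F2 xb y2 v"
    unfolding coderivative_iff using w[OF y(1)] by (force simp: algebra_simps)
  ultimately have "- w + (u + w) \<in> coderivative F1 xb y1 v + coderivative F2 xb y2 v"
    by (rule set_plus_intro)
  then show "u \<in> coderivative F1 xb y1 v + coderivative F2 xb y2 v"
    by simp
qed

theorem theorem11p1:
  fixes F1 F2 :: "real ^ 'n \<Rightarrow> (real ^ 'p) set"
  assumes "convex (gph F1)" and "convex (gph F2)"
    and "rel_interior (gph F1) \<inter> rel_interior (gph F2) \<noteq> {}"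
  shows "\<forall>xb yb v. (xb, yb) \<in> gph (setmap_sum F1 F2) \<longrightarrow>
    coderivative (setmap_sum F1 F2) xb yb v =
      (\<Inter>(y1, y2) \<in> sum_decomp F1 F2 xb yb.
        coderivative F1 xb y1 v + coderivative F2 xb y2 v)"
proof (intro allI impI)
  fix xb yb v
  assume "(xb, yb) \<in> gph (setmap_sum F1 F2)"
  then have "sum_decomp F1 F2 xb yb \<noteq> {}"
    by (auto simp: gph_def setmap_sum_def sum_decomp_def)
  moreover have "coderivative F1 xb y1 v + coderivative F2 xb y2 v
      = coderivative (setmap_sum F1 F2) xb yb v"
    if "(y1, y2) \<in> sum_decomp F1 F2 xb yb" for y1 y2
    using that coderivative_sum_subset[of F1 xb y1 v F2 y2]
      coderivative_setmap_sum_subset[OF assms, of y1 xb y2 v]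
    by (auto simp: sum_decomp_def)
  ultimately show "coderivative (setmap_sum F1 F2) xb yb v =
      (\<Inter>(y1, y2) \<in> sum_decomp F1 F2 xb yb.
        coderivative F1 xb y1 v + coderivative F2 xb y2 v)"
    by fastforce
qed

end
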